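(* Let $n \ge 1$ be an integer. For any integer $k \geq 1$, the odd-indexed power sum $S_{2k-1}$ is given by $$S_{2k-1} = \frac{2}{4^{k}} \left[ (n+1) n^{2k-1} + \sum_{j=1}^{k-1} 4^j n^{2k-2j-1} \binom{2k-1}{2j} \sum \frac{(2j)!}{b_1! b_2! \cdots b_j!} \prod_{r=1}^{j} \left( \frac{1}{4^r (2r)!} \right)^{b_r} 2^m\, m! \binom{n+m+1}{2m+1} \right],$$ where, for $k=1$, the sum over $j$ is empty and the formula reads $S_1 = \frac{1}{2}n(n+1)$, and where, for each $j =1,2,\ldots,k-1$, the rightmost (inner) sum is over all $j$-tuples of nonnegative integers $(b_1,b_2,\ldots,b_j)$ satisfying the constraint $b_1 + 2b_2 + \cdots + j b_j = j$, with $m = b_1 + b_2 +\cdots +b_j$.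
   Context: For integers $m \ge 0$ and $n \ge 1$, $S_m = 1^m + 2^m + \cdots + n^m$ denotes the sum of the $m$th powers of the first $n$ positive integers (the dependence on $n$ is suppressed in the notation). *)

theory Defs
  imports Complex_Main "HOL-Library.FuncSet"
begin

definition power_sum :: "nat \<Rightarrow> nat \<Rightarrow> nat" where
  "power_sum m n = (\<Sum>i=1..n. i ^ m)"

text \<open>
  A tuple \<open>(b\<^sub>1, \<dots>, b\<^sub>j)\<close> of natural numbers is encoded as an extensional function on \<open>{1..j}\<close>,
  so that distinct functions represent distinct tuples and each tuple is counted once.
\<close>

definition weighted_tuples :: "nat \<Rightarrow> (nat \<Rightarrow> nat) set" where
  "weighted_tuples j = {b \<in> {1..j} \<rightarrow>\<^sub>E UNIV. (\<Sum>r=1..j. r * b r) = j}"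

text \<open>The set is finite, so sums over it are not subject to the convention for infinite sets.\<close>

lemma finite_weighted_tuples: "finite (weighted_tuples j)"
proof (rule finite_subset)
  show "weighted_tuples j \<subseteq> {1..j} \<rightarrow>\<^sub>E {..j}"
  proof
    fix b assume b: "b \<in> weighted_tuples j"
    have "b r \<le> j" if r: "r \<in> {1..j}" for r
    proof -
      have "b r \<le> r * b r" using r by simp
      also have "\<dots> \<le> (\<Sum>s=1..j. s * b s)" using r by (intro member_le_sum) auto
      also have "\<dots> = j" using b by (simp add: weighted_tuples_def)
      finally show ?thesis .
    qed
    with b show "b \<in> {1..j} \<rightarrow>\<^sub>E {..j}"
      by (auto simp: weighted_tuples_def PiE_iff)
  qed
  show "finite ({1..j} \<rightarrow>\<^sub>E {..j})" by (intro finite_PiE) auto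
qed

end

theory Submission
  imports Defs "HOL-Computational_Algebra.Formal_Power_Series"
begin

text \<open>
  The terms \<open>i\<^sup>2\<^sup>k\<^sup>-\<^sup>1\<close> are expanded about the centre \<open>n/2\<close> of the range \<open>0, \<dots>, n\<close>. The
  reflection \<open>i \<mapsto> n - i\<close> kills the odd central moments, so only the even moments
  \<open>T\<^sub>j = (\<Sum>i\<le>n. (i - n/2)\<^sup>2\<^sup>j)\<close> remain. The moment \<open>T\<^sub>0 = n + 1\<close> gives the isolated term of the
  formula, and the claim is that the inner sum over tuples is \<open>T\<^sub>j\<close> for \<open>j \<ge> 1\<close>.

  Up to the factor \<open>(2j)!\<close>, \<open>T\<^sub>j\<close> is the coefficient of \<open>x\<^sup>2\<^sup>j\<close> in \<open>(\<Sum>i\<le>n. exp ((i - n/2) x))\<close>. With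
  \<open>u = exp (x/2)\<close> and \<open>v = 1/u\<close> this sum is \<open>(\<Sum>i\<le>n. u\<^sup>i v\<^sup>n\<^sup>-\<^sup>i)\<close>, a Chebyshev polynomial of the second
  kind in \<open>u + v\<close>. Its expansion in powers of \<open>w = u + v - 2\<close> has the binomial coefficients
  \<open>C(n + m + 1, 2m + 1)\<close> (lemma \<open>sum_powers_inverse_pair\<close>). Centring at \<open>2\<close> makes the constant term
  of \<open>w = (\<Sum>r\<ge>1. 2 x\<^sup>2\<^sup>r / (4\<^sup>r (2r)!))\<close> vanish, so the multinomial theorem turns the coefficient of
  \<open>x\<^sup>2\<^sup>j\<close> in \<open>w\<^sup>m\<close> into a finite sum over the tuples \<open>b\<close> with \<open>(\<Sum>r. r b\<^sub>r) = j\<close> and \<open>(\<Sum>r. b\<^sub>r) = m\<close>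
  (lemma \<open>nth_power_sum_monomials\<close>).
\<close>

section \<open>The multinomial theorem\<close>

definition multinomial :: "'a set \<Rightarrow> ('a \<Rightarrow> nat) \<Rightarrow> nat" where
  "multinomial R b = fact (\<Sum>r\<in>R. b r) div (\<Prod>r\<in>R. fact (b r))"

lemma prod_fact_dvd_fact_sum:
  assumes "finite R"
  shows "(\<Prod>r\<in>R. fact (b r)) dvd (fact (\<Sum>r\<in>R. b r) :: nat)"
  using assms
proof (induction R rule: finite_induct)
  case (insert x R)
  have "fact (b x) * (\<Prod>r\<in>R. fact (b r)) dvd (fact (b x) * fact (\<Sum>r\<in>R. b r) :: nat)"
    using insert.IH by (intro mult_dvd_mono) auto
  also have "\<dots> dvd fact (b x + (\<Sum>r\<in>R. b r))"
    by (rule fact_fact_dvd_fact)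
  finally show ?case using insert.hyps by simp
qed simp

lemma prod_fact_times_multinomial:
  assumes "finite R"
  shows "(\<Prod>r\<in>R. fact (b r)) * multinomial R b = fact (\<Sum>r\<in>R. b r)"
  using prod_fact_dvd_fact_sum[OF assms] by (simp add: multinomial_def)

lemma of_nat_multinomial:
  assumes "finite R"
  shows "(of_nat (multinomial R b) :: 'b :: field_char_0) =
    fact (\<Sum>r\<in>R. b r) / (\<Prod>r\<in>R. fact (b r))"
proof -
  have "(\<Prod>r\<in>R. fact (b r)) * (of_nat (multinomial R b) :: 'b) = fact (\<Sum>r\<in>R. b r)"
    using arg_cong[OF prod_fact_times_multinomial[OF assms, of b], of "of_nat :: nat \<Rightarrow> 'b"]
    by simp
  then show ?thesis using assms by (simp add: field_simps)
qed

lemma multinomial_insert: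
  assumes "finite R" "x \<notin> R"
  shows "multinomial (insert x R) b =
    (b x + (\<Sum>r\<in>R. b r) choose b x) * multinomial R b"
proof -
  let ?s = "\<Sum>r\<in>R. b r" and ?p = "\<Prod>r\<in>R. fact (b r) :: nat"
  have "?p * fact (b x) * multinomial (insert x R) b = fact (b x + ?s)"
    using prod_fact_times_multinomial[of "insert x R" b] assms by (simp add: mult_ac)
  also have "\<dots> = fact (b x) * fact ?s * (b x + ?s choose b x)"
    using binomial_fact_lemma[of "b x" "b x + ?s"] by simp
  also have "\<dots> = ?p * fact (b x) * ((b x + ?s choose b x) * multinomial R b)"
    using prod_fact_times_multinomial[OF assms(1), of b, symmetric]
    by (simp only: mult_ac)
  finally show ?thesis using assms by simp
qed

text \<open>Exponent vectors are extensional, so that each monomial corresponds to exactly one of them.\<close>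

definition exponents :: "'a set \<Rightarrow> nat \<Rightarrow> ('a \<Rightarrow> nat) set" where
  "exponents R m = {b \<in> R \<rightarrow>\<^sub>E UNIV. (\<Sum>r\<in>R. b r) = m}"

lemma finite_exponents:
  assumes "finite R"
  shows "finite (exponents R m)"
proof (rule finite_subset)
  show "exponents R m \<subseteq> R \<rightarrow>\<^sub>E {..m}"
    using assms by (auto simp: exponents_def PiE_iff extensional_def intro: member_le_sum)
  show "finite (R \<rightarrow>\<^sub>E {..m})" using assms by (intro finite_PiE) auto
qed

text \<open>
  The binomial theorem splits off one variable \<open>x\<close>. An exponent vector on \<open>insert x R\<close> is then a
  pair of the exponent \<open>c\<close> of \<open>x\<close> and a vector on \<open>R\<close> of total degree \<open>m - c\<close>, and the binomial
  factor is the one in \<open>multinomial_insert\<close>.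
\<close>

theorem multinomial_theorem:
  fixes f :: "'a \<Rightarrow> 'b :: comm_semiring_1"
  assumes "finite R"
  shows "(\<Sum>r\<in>R. f r) ^ m =
    (\<Sum>b\<in>exponents R m. of_nat (multinomial R b) * (\<Prod>r\<in>R. f r ^ b r))"
  using assms
proof (induction R arbitrary: m rule: finite_induct)
  case empty
  have "exponents {} m = (if m = 0 then {\<lambda>_ :: 'a. undefined} else {})"
    by (auto simp: exponents_def)
  then show ?case by (cases m) (simp_all add: multinomial_def)
next
  case (insert x R)
  let ?t = "\<lambda>R b. of_nat (multinomial R b) * (\<Prod>r\<in>R. f r ^ b r)"
  have upd: "?t (insert x R) (b(x := c)) = of_nat (m choose c) * f x ^ c * ?t R b"
    if "c \<le> m" "b \<in> exponents R (m - c)" for b c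
  proof -
    have on_R: "(b(x := c)) r = b r" if "r \<in> R" for r
      using that insert.hyps by auto
    have sum_R: "(\<Sum>r\<in>R. (b(x := c)) r) = m - c"
      using that on_R by (simp add: exponents_def)
    have "multinomial R (b(x := c)) = multinomial R b"
      unfolding multinomial_def using on_R by (metis (mono_tags, lifting) prod.cong sum.cong)
    moreover have "(\<Prod>r\<in>R. f r ^ (b(x := c)) r) = (\<Prod>r\<in>R. f r ^ b r)"
      using on_R by (intro prod.cong) auto
    ultimately show ?thesis
      using insert.hyps that sum_R by (simp add: multinomial_insert mult_ac)
  qed
  have "(\<Sum>r\<in>insert x R. f r) ^ m =
      (\<Sum>c\<le>m. of_nat (m choose c) * f x ^ c * (\<Sum>r\<in>R. f r) ^ (m - c))"
    using insert.hyps by (simp add: binomial_ring)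
  also have "\<dots> = (\<Sum>c\<le>m. \<Sum>b\<in>exponents R (m - c). of_nat (m choose c) * f x ^ c * ?t R b)"
    by (simp only: insert.IH sum_distrib_left)
  also have "\<dots> = (\<Sum>(c, b)\<in>(SIGMA c:{..m}. exponents R (m - c)).
      of_nat (m choose c) * f x ^ c * ?t R b)"
    using insert.hyps by (intro sum.Sigma) (auto simp: finite_exponents)
  also have "\<dots> = (\<Sum>b\<in>exponents (insert x R) m. ?t (insert x R) b)"
  proof (rule sum.reindex_bij_witness[where i = "\<lambda>b. (b x, b(x := undefined))"
        and j = "\<lambda>(c, b). b(x := c)"], goal_cases)
    case (1 p)
    then show ?case using insert.hyps by (auto simp: exponents_def PiE_iff extensional_def)
  next
    case (2 p)
    obtain c b where p: "p = (c, b)" by (cases p)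
    have "(\<Sum>r\<in>R. if r = x then c else b r) = (\<Sum>r\<in>R. b r)"
      using insert.hyps by (intro sum.cong) auto
    then show ?case using 2 insert.hyps
      by (auto simp: p exponents_def PiE_iff extensional_def)
  next
    case (3 b)
    then show ?case by auto
  next
    case (4 b)
    have "(\<Sum>r\<in>R. if r = x then undefined else b r) = (\<Sum>r\<in>R. b r)"
      using insert.hyps by (intro sum.cong) auto
    then show ?case using 4 insert.hyps
      by (auto simp: exponents_def PiE_iff extensional_def)
  next
    case (5 p)
    then show ?case using upd by auto
  qed
  finally show ?case .
qed

section \<open>Coefficients of powers of power series\<close>

unbundle fps_syntax

lemma nth_power_sum_monomials:
  fixes a :: "'a \<Rightarrow> 'b :: comm_ring_1"
  assumes "finite R"
  shows "((\<Sum>r\<in>R. fps_const (a r) * fps_X ^ d r) ^ m) $ N =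
    (\<Sum>b | b \<in> exponents R m \<and> (\<Sum>r\<in>R. d r * b r) = N.
      of_nat (multinomial R b) * (\<Prod>r\<in>R. a r ^ b r))"
proof -
  have monomial: "(\<Prod>r\<in>R. (fps_const (a r) * fps_X ^ d r) ^ b r) =
      fps_const (\<Prod>r\<in>R. a r ^ b r) * fps_X ^ (\<Sum>r\<in>R. d r * b r)" for b
    using assms
    by (induction R rule: finite_induct)
       (simp_all add: power_mult_distrib power_add fps_const_mult[symmetric] mult_ac
          flip: power_mult del: fps_const_mult)
  have "((\<Sum>r\<in>R. fps_const (a r) * fps_X ^ d r) ^ m) $ N =
      (\<Sum>b\<in>exponents R m. of_nat (multinomial R b) *
        (if (\<Sum>r\<in>R. d r * b r) = N then \<Prod>r\<in>R. a r ^ b r else 0))"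
    unfolding multinomial_theorem[OF assms] fps_sum_nth monomial
    by (intro sum.cong) (auto simp flip: fps_of_nat)
  also have "\<dots> = (\<Sum>b\<in>exponents R m. if (\<Sum>r\<in>R. d r * b r) = N
      then of_nat (multinomial R b) * (\<Prod>r\<in>R. a r ^ b r) else 0)"
    by (intro sum.cong) auto
  also have "\<dots> = (\<Sum>b | b \<in> exponents R m \<and> (\<Sum>r\<in>R. d r * b r) = N.
      of_nat (multinomial R b) * (\<Prod>r\<in>R. a r ^ b r))"
    by (simp add: sum.inter_filter finite_exponents[OF assms])
  finally show ?thesis .
qed

lemma fps_power_nth_cong:
  fixes f g :: "'a :: semiring_1 fps"
  assumes "\<And>i. i \<le> N \<Longrightarrow> f $ i = g $ i" and "s \<le> N"
  shows "(f ^ m) $ s = (g ^ m) $ s"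
  using assms(2)
proof (induction m arbitrary: s)
  case (Suc m)
  then show ?case using assms(1) by (auto simp: fps_mult_nth intro!: sum.cong)
qed simp

section \<open>Chebyshev polynomials in powers of \<open>u + v - 2\<close>\<close>

text \<open>
  Both sides satisfy the recurrence \<open>F\<^sub>n\<^sub>+\<^sub>2 = (u + v) F\<^sub>n\<^sub>+\<^sub>1 - F\<^sub>n\<close>; for the right-hand side this is
  Pascal's rule applied twice. A bound \<open>M\<close> beyond \<open>n\<close> adds only vanishing binomial coefficients, and
  leaving it free allows one common range of summation for the three terms of the recurrence.
\<close>

lemma sum_powers_inverse_pair:
  fixes u v :: "'a :: comm_ring_1"
  assumes uv: "u * v = 1" and "n \<le> M"
  shows "(\<Sum>i\<le>n. u ^ i * v ^ (n - i)) =
    (\<Sum>m\<le>M. of_nat (n + m + 1 choose (2 * m + 1)) * (u + v - 2) ^ m)"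
proof -
  define F where "F n = (\<Sum>i\<le>n. u ^ i * v ^ (n - i))" for n
  define w where "w = u + v - 2"
  define G where "G n = (\<Sum>m\<le>M. of_nat (n + m + 1 choose (2 * m + 1)) * w ^ m)" for n
  have F_v: "F (Suc n) = v * F n + u ^ Suc n" for n
    unfolding F_def by (auto simp: sum_distrib_left Suc_diff_le mult_ac intro!: sum.cong)
  have F_u: "F (Suc n) = u * F n + v ^ Suc n" for n
    unfolding F_def by (subst sum.atMost_Suc_shift) (simp add: sum_distrib_left mult_ac)
  have F_rec: "F (Suc (Suc n)) = (w + 2) * F (Suc n) - F n" for n
  proof -
    have "(w + 2) * F (Suc n) = u * F (Suc n) + v * F (Suc n)"
      by (simp add: w_def algebra_simps)
    also have "u * F (Suc n) = F (Suc (Suc n)) - v ^ Suc (Suc n)"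
      using F_u[of "Suc n"] by simp
    also have "v * F (Suc n) = (u * v) * F n + v ^ Suc (Suc n)"
      using F_u[of n] by (simp add: algebra_simps)
    finally show ?thesis by (simp add: uv)
  qed
  have G_rec: "G (Suc (Suc n)) = (w + 2) * G (Suc n) - G n" if le: "Suc (Suc n) \<le> M" for n
  proof -
    obtain M' where M': "M = Suc M'"
      using Suc_le_D[OF le] by blast
    have pascal: "(n + Suc m + 3 choose (2 * m + 3)) + (n + Suc m + 1 choose (2 * m + 3)) =
        (n + m + 2 choose (2 * m + 1)) + 2 * (n + Suc m + 2 choose (2 * m + 3))" for m
      by (simp add: numeral_eq_Suc)
    \<comment> \<open>The top coefficient that the shift by \<open>w\<close> pushes beyond \<open>M\<close> is zero.\<close>
    have top: "n + M + 2 choose (2 * M + 1) = 0"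
      using le by (intro binomial_eq_0) simp
    have "w * G (Suc n) = (\<Sum>m\<le>M. of_nat (n + m + 2 choose (2 * m + 1)) * w ^ Suc m)"
      by (simp add: G_def sum_distrib_left mult_ac)
    also have "\<dots> = (\<Sum>m\<le>M'. of_nat (n + m + 2 choose (2 * m + 1)) * w ^ Suc m)"
      by (simp only: M' sum.atMost_Suc top[unfolded M'] of_nat_0 mult_zero_left add_0_right)
    finally have w_G: "w * G (Suc n) = \<dots>" .
    have split: "G l = of_nat (l + 1) +
        (\<Sum>m\<le>M'. of_nat (l + Suc m + 1 choose (2 * m + 3)) * w ^ Suc m)" for l
      unfolding G_def M' by (subst sum.atMost_Suc_shift) (simp add: numeral_eq_Suc)
    have "G (Suc (Suc n)) + G n = 2 * of_nat (n + 2) +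
        (\<Sum>m\<le>M'. of_nat ((n + Suc m + 3 choose (2 * m + 3)) +
          (n + Suc m + 1 choose (2 * m + 3))) * w ^ Suc m)"
      unfolding split by (simp add: algebra_simps sum.distrib numeral_eq_Suc del: binomial_Suc_Suc)
    also have "\<dots> = 2 * of_nat (n + 2) +
        (\<Sum>m\<le>M'. of_nat ((n + m + 2 choose (2 * m + 1)) +
          2 * (n + Suc m + 2 choose (2 * m + 3))) * w ^ Suc m)"
      by (simp only: pascal)
    also have "\<dots> = w * G (Suc n) + 2 * G (Suc n)"
      unfolding w_G unfolding split[of "Suc n"]
      by (simp add: algebra_simps sum.distrib sum_distrib_left del: binomial_Suc_Suc)
    finally show ?thesis by (simp add: algebra_simps)
  qed
  have "n \<le> M \<Longrightarrow> F n = G n" for n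
  proof (induction n rule: less_induct)
    case (less n)
    have G_first: "(\<Sum>m\<le>M. of_nat (l + m + 1 choose (2 * m + 1)) * w ^ m) =
        (\<Sum>m\<le>l. of_nat (l + m + 1 choose (2 * m + 1)) * w ^ m)" if "l \<le> M" for l
      using that by (intro sum.mono_neutral_right)
        (auto simp: binomial_eq_0 simp del: binomial_Suc_Suc)
    consider "n = 0" | "n = 1" | l where "n = Suc (Suc l)"
      by (metis One_nat_def not0_implies_Suc)
    then show ?case
    proof cases
      case 1
      then show ?thesis using G_first[of 0] by (simp add: F_def G_def)
    next
      case 2
      then show ?thesis using G_first[of 1] less.prems
        by (simp add: F_def G_def w_def numeral_eq_Suc)
    next
      case 3
      then show ?thesis using less.IH[of l] less.IH[of "Suc l"] less.prems F_rec G_rec by simp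
    qed
  qed
  with assms show ?thesis by (simp add: F_def G_def w_def)
qed

section \<open>Central moments of \<open>0, \<dots>, n\<close>\<close>

lemma odd_central_moment:
  assumes "odd q"
  shows "(\<Sum>i\<le>n. (real i - real n / 2) ^ q) = 0"
proof -
  have "(\<Sum>i\<le>n. (real i - real n / 2) ^ q) = (\<Sum>i\<le>n. (real (n - i) - real n / 2) ^ q)"
    using sum.atLeastAtMost_rev[of "\<lambda>i. (real i - real n / 2) ^ q" 0 n]
    by (simp add: atMost_atLeast0)
  also have "\<dots> = (\<Sum>i\<le>n. - ((real i - real n / 2) ^ q))"
  proof (intro sum.cong refl)
    fix i assume "i \<in> {..n}"
    then have "real (n - i) - real n / 2 = - (real i - real n / 2)" by (simp add: of_nat_diff)
    then show "(real (n - i) - real n / 2) ^ q = - ((real i - real n / 2) ^ q)"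
      using assms by (metis power_minus_odd)
  qed
  finally show ?thesis by (simp add: sum_negf)
qed

text \<open>
  The series \<open>exp (x/2) + exp (-x/2) - 2\<close> agrees up to degree \<open>2j\<close> with the polynomial of its terms
  of index \<open>1, \<dots>, j\<close>, which is all that the coefficient of \<open>x\<^sup>2\<^sup>j\<close> in a power of it can see.
\<close>

lemma nth_power_exp_pair:
  defines "w \<equiv> fps_exp (1 / 2 :: real) + fps_exp (- 1 / 2) - 2"
  shows "(w ^ m) $ (2 * j) =
    (\<Sum>b | b \<in> weighted_tuples j \<and> (\<Sum>r = 1..j. b r) = m.
      real (multinomial {1..j} b) * (\<Prod>r = 1..j. (2 / (4 ^ r * fact (2 * r))) ^ b r))"
proof -
  let ?a = "\<lambda>r. 2 / (4 ^ r * fact (2 * r)) :: real"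
  let ?p = "\<Sum>r = 1..j. fps_const (?a r) * fps_X ^ (2 * r)"
  have coeff: "w $ s = ?p $ s" if "s \<le> 2 * j" for s
  proof (cases "even s \<and> s > 0")
    case True
    then obtain r where s: "s = 2 * r" by auto
    with True that have r: "r \<in> {1..j}" by auto
    have "?p $ s = (\<Sum>r'\<in>{1..j}. if r = r' then ?a r' else 0)"
      unfolding fps_sum_nth s by (intro sum.cong) auto
    also have "\<dots> = ?a r" using r by (simp only: sum.delta' finite_atLeastAtMost if_True)
    also have "\<dots> = w $ s"
      using r by (simp add: w_def s power_mult power_divide numeral_fps_const)
    finally show ?thesis by simp
  next
    case False
    have "?p $ s = 0" unfolding fps_sum_nth using False by (intro sum.neutral) auto
    moreover have "w $ s = 0"
      using False by (cases "s = 0") (auto simp: w_def numeral_fps_const power_minus_odd)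
    ultimately show ?thesis by simp
  qed
  have "(w ^ m) $ (2 * j) = (?p ^ m) $ (2 * j)"
    using coeff by (rule fps_power_nth_cong) auto
  also have "\<dots> = (\<Sum>b | b \<in> exponents {1..j} m \<and> (\<Sum>r = 1..j. 2 * r * b r) = 2 * j.
      real (multinomial {1..j} b) * (\<Prod>r = 1..j. ?a r ^ b r))"
    by (rule nth_power_sum_monomials) simp
  also have "{b. b \<in> exponents {1..j} m \<and> (\<Sum>r = 1..j. 2 * r * b r) = 2 * j} =
      {b. b \<in> weighted_tuples j \<and> (\<Sum>r = 1..j. b r) = m}"
    by (auto simp: exponents_def weighted_tuples_def mult.assoc simp flip: sum_distrib_left)
  finally show ?thesis .
qed

lemma even_central_moment:
  "(\<Sum>i\<le>n. (real i - real n / 2) ^ (2 * j)) =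
    (\<Sum>b \<in> weighted_tuples j.
       let m = (\<Sum>r = 1..j. b r) in
         fact (2 * j) / (\<Prod>r = 1..j. fact (b r)) *
         (\<Prod>r = 1..j. (1 / (4 ^ r * fact (2 * r))) ^ b r) *
         2 ^ m * fact m * real ((n + m + 1) choose (2 * m + 1)))"
    (is "_ = (\<Sum>b\<in>_. ?t b)")
proof -
  define u v :: "real fps" where "u = fps_exp (1 / 2)" and "v = fps_exp (- 1 / 2)"
  define g where "g b = sum b {1..j}" for b :: "nat \<Rightarrow> nat"
  let ?c = "\<lambda>m. real (n + m + 1 choose (2 * m + 1))"
  have uv: "u * v = 1"
    unfolding u_def v_def by (simp flip: fps_exp_add_mult)
  have exp_i: "u ^ i * v ^ (n - i) = fps_exp (real i - real n / 2)" if "i \<le> n" for i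
    using that unfolding u_def v_def
    by (simp add: fps_exp_power_mult of_nat_diff field_simps flip: fps_exp_add_mult)
  have g_le: "g b \<le> j" if "b \<in> weighted_tuples j" for b
  proof -
    have "g b \<le> (\<Sum>r = 1..j. r * b r)" unfolding g_def by (intro sum_mono) auto
    with that show ?thesis by (simp add: weighted_tuples_def)
  qed
  have summand: "fact (2 * j) * ?c (g b) *
      (real (multinomial {1..j} b) * (\<Prod>r = 1..j. (2 / (4 ^ r * fact (2 * r))) ^ b r)) = ?t b" for b
  proof -
    have "(\<Prod>r = 1..j. (2 / (4 ^ r * fact (2 * r)) :: real) ^ b r) =
        (\<Prod>r = 1..j. 2 ^ b r * (1 / (4 ^ r * fact (2 * r))) ^ b r)"
      by (intro prod.cong) (simp_all flip: power_mult_distrib)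
    also have "\<dots> = 2 ^ g b * (\<Prod>r = 1..j. (1 / (4 ^ r * fact (2 * r))) ^ b r)"
      by (simp only: prod.distrib power_sum g_def)
    finally show ?thesis
      by (simp add: of_nat_multinomial Let_def g_def mult_ac)
  qed
  have "(\<Sum>i\<le>n. (real i - real n / 2) ^ (2 * j)) =
      fact (2 * j) * (\<Sum>i\<le>n. u ^ i * v ^ (n - i)) $ (2 * j)"
    by (simp add: fps_sum_nth exp_i sum_distrib_left)
  \<comment> \<open>The range \<open>m \<le> n + j\<close> includes all \<open>m \<le> j\<close>, hence the sum of every weighted tuple.\<close>
  also have "(\<Sum>i\<le>n. u ^ i * v ^ (n - i)) =
      (\<Sum>m\<le>n + j. of_nat (n + m + 1 choose (2 * m + 1)) * (u + v - 2) ^ m)"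
    by (rule sum_powers_inverse_pair[OF uv]) simp
  also have "fact (2 * j) * \<dots> $ (2 * j) =
      (\<Sum>m\<le>n + j. fact (2 * j) * (?c m * ((u + v - 2) ^ m) $ (2 * j)))"
    unfolding fps_sum_nth sum_distrib_left by (simp flip: fps_of_nat)
  also have "\<dots> = (\<Sum>m\<le>n + j. \<Sum>b | b \<in> weighted_tuples j \<and> g b = m. ?t b)"
    unfolding nth_power_exp_pair[folded g_def u_def v_def] sum_distrib_left
  proof (intro sum.cong refl)
    fix m b assume "b \<in> {b \<in> weighted_tuples j. g b = m}"
    then have "g b = m" by simp
    then show "fact (2 * j) * (?c m * (real (multinomial {1..j} b) *
        (\<Prod>r = 1..j. (2 / (4 ^ r * fact (2 * r))) ^ b r))) = ?t b"
      using summand[of b] by (simp only: mult.assoc)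
  qed (simp only: g_def)
  also have "\<dots> = (\<Sum>b\<in>weighted_tuples j. ?t b)"
    using sum.group[of "weighted_tuples j" "{..n + j}" g ?t] finite_weighted_tuples g_le
    by (force simp: image_subset_iff)
  finally show ?thesis .
qed

section \<open>Odd power sums\<close>

lemma sum_even_odd_split: "(\<Sum>q<2 * k. f q) = (\<Sum>j<k. f (2 * j)) + (\<Sum>j<k. f (2 * j + 1))"
  for f :: "nat \<Rightarrow> 'a :: comm_monoid_add"
  by (induction k) (simp_all add: ac_simps)

theorem theorem3:
  fixes n k :: nat
  assumes "n \<ge> 1" and "k \<ge> 1"
  shows "real (power_sum (2 * k - 1) n) =
    2 / 4 ^ k *
      ((real n + 1) * real n ^ (2 * k - 1) +
       (\<Sum>j = 1..k - 1.
          4 ^ j * real n ^ (2 * k - 2 * j - 1) * real ((2 * k - 1) choose (2 * j)) *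
          (\<Sum>b \<in> weighted_tuples j.
             let m = (\<Sum>r = 1..j. b r) in
               fact (2 * j) / (\<Prod>r = 1..j. fact (b r)) *
               (\<Prod>r = 1..j. (1 / (4 ^ r * fact (2 * r))) ^ b r) *
               2 ^ m * fact m * real ((n + m + 1) choose (2 * m + 1)))))"
proof -
  define p where "p = 2 * k - 1"
  have p: "p > 0" "{..p} = {..<2 * k}" using assms by (auto simp: p_def)
  define T where "T q = (\<Sum>i\<le>n. (real i - real n / 2) ^ q)" for q
  let ?f = "\<lambda>q. real (p choose q) * (real n / 2) ^ (p - q) * T q"
  have T_odd: "T (2 * j + 1) = 0" for j
    unfolding T_def by (rule odd_central_moment) simp
  \<comment> \<open>As \<open>p = 2k - 1\<close> is odd, \<open>2\<^sup>p = 4\<^sup>k / 2\<close>, which is where the factor \<open>2 / 4\<^sup>k\<close> comes from.\<close>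
  have half: "(real n / 2) ^ (p - 2 * j) = 2 / 4 ^ k * (4 ^ j * real n ^ (2 * k - 2 * j - 1))"
    if "j < k" for j
  proof -
    have "(2::real) ^ (p - 2 * j) * (2 * 4 ^ j) = 2 ^ (p - 2 * j + (1 + 2 * j))"
      by (simp add: power_add power_mult)
    also have "\<dots> = 4 ^ k"
      using that by (simp add: p_def power_mult)
    finally have "(2::real) ^ (p - 2 * j) * (2 * 4 ^ j) = 4 ^ k" .
    moreover have "p - 2 * j = 2 * k - 2 * j - 1" by (simp add: p_def)
    ultimately show ?thesis by (simp add: power_divide field_simps)
  qed
  have "real (power_sum p n) = (\<Sum>i\<le>n. real i ^ p)"
    using p(1) unfolding power_sum_def of_nat_sum of_nat_power
    by (intro sum.mono_neutral_left) auto
  also have "\<dots> = (\<Sum>i\<le>n. \<Sum>q\<le>p. real (p choose q) * (real n / 2) ^ (p - q) *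
      (real i - real n / 2) ^ q)"
  proof (intro sum.cong refl)
    fix i
    have "real i ^ p = ((real i - real n / 2) + real n / 2) ^ p" by simp
    then show "real i ^ p = (\<Sum>q\<le>p. real (p choose q) * (real n / 2) ^ (p - q) *
        (real i - real n / 2) ^ q)"
      by (simp only: binomial_ring mult_ac)
  qed
  also have "\<dots> = (\<Sum>q\<le>p. ?f q)"
    unfolding T_def sum_distrib_left by (rule sum.swap)
  also have "\<dots> = (\<Sum>j<k. ?f (2 * j))"
    unfolding p(2) sum_even_odd_split by (simp only: T_odd) simp
  also have "\<dots> = (\<Sum>j<k. 2 / 4 ^ k *
      (4 ^ j * real n ^ (2 * k - 2 * j - 1) * real (p choose (2 * j)) * T (2 * j)))"
    by (intro sum.cong) (simp_all add: half)
  also have "\<dots> = 2 / 4 ^ k *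
      ((real n + 1) * real n ^ p +
       (\<Sum>j = 1..k - 1. 4 ^ j * real n ^ (2 * k - 2 * j - 1) * real (p choose (2 * j)) * T (2 * j)))"
  proof -
    have "{..<k} = insert 0 {1..k - 1}" using assms by auto
    then show ?thesis by (simp add: sum_distrib_left distrib_left T_def p_def mult_ac)
  qed
  finally show ?thesis unfolding T_def even_central_moment p_def .
qed

end
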